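(* For all characters $A,B,B',C\in\widehat{\mathbb F_q}$ and all $x,y\in\mathbb F_q$, the following three identities hold. (1) $$\mathbb F_1(A;B,B';C;x,y)=C(-1)\,\overline B(1-x)\,\overline{B'}(1-y)\;\mathbb F_1\left(\overline AC;B,B';C;\frac x{x-1},\frac y{y-1}\right).$$ (2) $$\varepsilon(x-y)\,\mathbb F_1(A;B,B';C;x,y)=\varepsilon(y)\,\overline A(1-x)\;\mathbb F_1\left(A;\overline B\,\overline{B'}C,B';C;\frac x{x-1},\frac{y-x}{1-x}\right).$$ (3) $$\varepsilon(x-y)\,\mathbb F_1(A;B,B';C;x,y)=\varepsilon(y)\,C(-1)\,\overline A\,\overline BC(1-x)\,\overline{B'}(1-y)\;\mathbb F_1\left(\overline AC;\overline B\,\overline{B'}C,B';C;x,\frac{x-y}{1-y}\right).$$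
   Context: Let $p$ be a prime, $r\ge1$ an integer, $q=p^r$, and $\mathbb F_q$ the finite field with $q$ elements. $\widehat{\mathbb F_q}$ denotes the group of (complex-valued) multiplicative characters of $\mathbb F_q^*$; every character $\chi$, including the trivial character $\varepsilon$, is extended to $\mathbb F_q$ by $\chi(0)=0$. $\overline\chi$ is the inverse of $\chi$. Juxtaposition of characters denotes their product, and e.g. $AC(-1)$ means $(AC)(-1)$, $\overline AC$ means the product of $\overline A$ and $C$, and $\overline A\,\overline BC(1-x)$ is the value of the product character $\overline A\,\overline B C$ at $1-x$. For $A,B,B',C\in\widehat{\mathbb F_q}$ and $x,y\in\mathbb F_q$, $$\mathbb F_1(A;B,B';C;x,y)=\varepsilon(xy)\,AC(-1)\sum_{u\in\mathbb F_q}A(u)\,\overline AC(1-u)\,\overline B(1-ux)\,\overline{B'}(1-uy).$$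
   Formalization: The identities are stated only where arguments are defined: (1) for x,y≠1, (2) for x≠1, (3) for y≠1. In (3) the points x=1, y∉{0,1} are also excluded: there the right side is 0, but for trivial characters the left side is q−3, nonzero for q≥4. *)

theory Defs
  imports Complex_Main "HOL-Computational_Algebra.Primes" "HOL-Library.Function_Division"
begin

text \<open>
  A multiplicative character is a homomorphism from the nonzero elements of the field to the
  nonzero complex numbers, extended by \<open>0\<close> at \<open>0\<close>. The product \<open>A * B\<close> and the inverse
  \<open>inverse A\<close> of characters are the pointwise operations on functions; they respect the
  convention at \<open>0\<close>, since \<open>inverse 0 = 0\<close> in the complex numbers.
  The neutral element is \<open>\<epsilon>\<close> below, not the constant function \<open>1\<close>.
\<close>

definition mult_char :: "('a::finite_field \<Rightarrow> complex) \<Rightarrow> bool" where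
  "mult_char \<chi> \<longleftrightarrow>
     \<chi> 0 = 0 \<and>
     (\<forall>x. x \<noteq> 0 \<longrightarrow> \<chi> x \<noteq> 0) \<and>
     (\<forall>x y. x \<noteq> 0 \<longrightarrow> y \<noteq> 0 \<longrightarrow> \<chi> (x * y) = \<chi> x * \<chi> y)"

definition trivial_char :: "'a::finite_field \<Rightarrow> complex" (\<open>\<epsilon>\<close>) where
  "\<epsilon> x = (if x = 0 then 0 else 1)"

lemma mult_char_trivial: "mult_char \<epsilon>"
  by (simp add: mult_char_def trivial_char_def)

lemma mult_char_times: "mult_char A \<Longrightarrow> mult_char B \<Longrightarrow> mult_char (A * B)"
  by (simp add: mult_char_def)

lemma mult_char_inverse: "mult_char A \<Longrightarrow> mult_char (inverse A)"
  by (simp add: mult_char_def)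

lemma trivial_char_times: "mult_char A \<Longrightarrow> \<epsilon> * A = A"
  by (auto simp: mult_char_def trivial_char_def fun_eq_iff)

lemma inverse_char_times: "mult_char A \<Longrightarrow> inverse A * A = \<epsilon>"
  by (auto simp: mult_char_def trivial_char_def fun_eq_iff)

definition appell_F1 ::
  "('a::finite_field \<Rightarrow> complex) \<Rightarrow> ('a \<Rightarrow> complex) \<Rightarrow> ('a \<Rightarrow> complex) \<Rightarrow> ('a \<Rightarrow> complex) \<Rightarrow> 'a \<Rightarrow> 'a \<Rightarrow> complex"
where
  "appell_F1 A B B' C x y =
     \<epsilon> (x * y) * (A * C) (-1) *
       (\<Sum>u\<in>UNIV. A u * (inverse A * C) (1 - u) * (inverse B) (1 - u * x) * (inverse B') (1 - u * y))"

end

theory Submission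
  imports Defs
begin

text \<open>
  The sum defining \<open>appell_F1\<close> is a finite-field analogue of Euler's integral for the Appell
  function, and the three identities come from changes of the summation variable by Moebius
  transformations of the projective line. Each transformation sends two of the points \<open>0\<close>, \<open>1\<close>,
  \<open>1 / x\<close>, \<open>1 / y\<close>, infinity to \<open>0\<close> and \<open>1\<close> and a third one to infinity, so the summand keeps
  its shape and only the characters and the parameters change.

  The first identity is the reflection \<open>u \<mapsto> 1 - u\<close>, which exchanges the roles of \<open>A\<close> and
  \<open>inverse A * C\<close> (lemma \<open>appell_F1_reflect\<close>). The second is the Moebius map that fixes \<open>0\<close> and
  \<open>1\<close> and sends the zero \<open>1 / x\<close> of \<open>1 - u * x\<close> to infinity (lemma \<open>appell_F1_pfaff\<close>). It
  exchanges the characters attached to \<open>1 / x\<close> and to infinity. This is why \<open>inverse B * inverse B' * C\<close>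
  replaces \<open>B\<close>. The two points at which this map or its inverse is undefined are zeros of the
  respective summands, so nothing is lost.

  The third identity is the composition of the other two: the first is applied to the right-hand side
  of the second. This needs \<open>x \<noteq> 1\<close>; for \<open>x = 1\<close> the hypothesis gives \<open>y = 0\<close>, where both
  sides vanish.
\<close>

lemma mult_char_0 [simp]: "mult_char \<chi> \<Longrightarrow> \<chi> 0 = 0"
  by (simp add: mult_char_def)

lemma mult_char_nonzero: "mult_char \<chi> \<Longrightarrow> x \<noteq> 0 \<Longrightarrow> \<chi> x \<noteq> 0"
  by (simp add: mult_char_def)

lemma mult_char_mult: "mult_char \<chi> \<Longrightarrow> \<chi> (x * y) = \<chi> x * \<chi> y"
  by (cases "x = 0 \<or> y = 0") (auto simp: mult_char_def)

lemma mult_char_1 [simp]: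
  assumes "mult_char \<chi>"
  shows "\<chi> 1 = 1"
  using mult_char_mult[OF assms, of 1 1] mult_char_nonzero[OF assms, of 1] by simp

lemma mult_char_divide:
  assumes "mult_char \<chi>"
  shows "\<chi> (x / y) = \<chi> x / \<chi> y"
proof (cases "y = 0")
  case False
  then have "\<chi> (x / y) * \<chi> y = \<chi> x"
    using mult_char_mult[OF assms, of "x / y" y] by simp
  then show ?thesis
    using mult_char_nonzero[OF assms False] by (simp add: field_simps)
qed (use assms in simp)

lemma mult_char_minus_one_squared:
  assumes "mult_char \<chi>"
  shows "\<chi> (-1) * \<chi> (-1) = 1"
  using mult_char_mult[OF assms, of "-1" "-1"] assms by simp

lemma inverse_mult_char_minus_one:
  assumes "mult_char \<chi>"
  shows "inverse (\<chi> (-1)) = \<chi> (-1)"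
  using mult_char_minus_one_squared[OF assms] by (rule inverse_unique)

lemma inverse_inverse_char_times:
  assumes "mult_char A" "mult_char C"
  shows "inverse (inverse A * C) * C = A"
proof
  fix x show "(inverse (inverse A * C) * C) x = A x"
    using assms mult_char_nonzero[OF assms(2), of x] by (cases "x = 0") auto
qed

text \<open>
  The substitution \<open>u \<mapsto> 1 - u\<close> turns \<open>1 - u * x\<close> into
  \<open>1 - x + u * x = (1 - x) * (1 - u * (x / (x - 1)))\<close>, and the constant factor
  comes out of the sum.
\<close>

lemma appell_F1_reflect:
  fixes A B B' C :: "'a::finite_field \<Rightarrow> complex"
  assumes ch: "mult_char A" "mult_char B" "mult_char B'" "mult_char C"
    and xy: "x \<noteq> 1" "y \<noteq> 1"
  shows "appell_F1 A B B' C x y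
    = C (-1) * (inverse B) (1 - x) * (inverse B') (1 - y)
        * appell_F1 (inverse A * C) B B' C (x / (x - 1)) (y / (y - 1))"
proof -
  have factor: "1 - (1 - u) * z = (1 - z) * (1 - u * (z / (z - 1)))" if "z \<noteq> 1" for u z :: 'a
    using that by (simp add: field_simps)
  have "(\<Sum>u\<in>UNIV. A u * (inverse A * C) (1 - u) * (inverse B) (1 - u * x) * (inverse B') (1 - u * y))
    = (\<Sum>u\<in>UNIV. A (1 - u) * (inverse A * C) u * (inverse B) (1 - (1 - u) * x)
          * (inverse B') (1 - (1 - u) * y))"
    by (rule sum.reindex_bij_witness[of _ "\<lambda>u. 1 - u" "\<lambda>u. 1 - u"]) auto
  also have "\<dots> = (inverse B) (1 - x) * (inverse B') (1 - y)
      * (\<Sum>u\<in>UNIV. (inverse A * C) u * A (1 - u) * (inverse B) (1 - u * (x / (x - 1)))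
          * (inverse B') (1 - u * (y / (y - 1))))"
    unfolding factor[OF xy(1)] factor[OF xy(2)]
      mult_char_mult[OF mult_char_inverse[OF ch(2)]] mult_char_mult[OF mult_char_inverse[OF ch(3)]]
      sum_distrib_left
    by (intro sum.cong refl) (simp only: mult_ac)
  finally have sums:
    "(\<Sum>u\<in>UNIV. A u * (inverse A * C) (1 - u) * (inverse B) (1 - u * x) * (inverse B') (1 - u * y)) = \<dots>" .
  have eps: "\<epsilon> (x / (x - 1) * (y / (y - 1))) = \<epsilon> (x * y)"
    using xy by (simp add: trivial_char_def)
  have sign: "(A * C) (-1) = C (-1) * (inverse A * C * C) (-1)"
    using mult_char_minus_one_squared[OF ch(4)] inverse_mult_char_minus_one[OF ch(1)] by simp
  show ?thesis
    unfolding appell_F1_def inverse_inverse_char_times[OF ch(1,4)] sums eps sign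
    by (simp only: mult_ac)
qed

text \<open>
  The substitution is \<open>u = v / (w * d)\<close> with \<open>w = 1 - x\<close> and \<open>d = 1 - v * (x / (x - 1))\<close>, so that
  \<open>w * d = 1 - x + v * x\<close>. It turns \<open>1 - u\<close>, \<open>1 - u * x\<close> and \<open>1 - u * y\<close> into \<open>1 - v\<close>, \<open>1\<close> and
  \<open>1 - v * ((y - x) / (1 - x))\<close>, each divided by \<open>d\<close>. The powers of \<open>d\<close> collect to the character
  attached to \<open>d\<close> on the right-hand side, and \<open>w\<close> enters only through \<open>A u\<close>, which gives the factor
  \<open>(inverse A) (1 - x)\<close>.
\<close>

lemma appell_F1_pfaff:
  fixes A B B' C :: "'a::finite_field \<Rightarrow> complex"
  assumes ch: "mult_char A" "mult_char B" "mult_char B'" "mult_char C"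
    and x: "x \<noteq> 1"
  shows "\<epsilon> (x - y) * appell_F1 A B B' C x y
    = \<epsilon> y * (inverse A) (1 - x)
        * appell_F1 A (inverse B * inverse B' * C) B' C (x / (x - 1)) ((y - x) / (1 - x))"
proof -
  define w where "w = 1 - x"
  define d where "d v = 1 - v * (x / (x - 1))" for v
  define y' where "y' = (y - x) / (1 - x)"
  have w: "w \<noteq> 0" using x by (simp add: w_def)
  have wd: "w * d v = 1 - x + v * x" for v
    using x by (simp add: w_def d_def field_simps)
  have u1: "1 - v / (w * d v) = (1 - v) / d v"
    and u2: "1 - v / (w * d v) * x = 1 / d v"
    and u3: "1 - v / (w * d v) * y = (1 - v * y') / d v" if "d v \<noteq> 0" for v
  proof -
    have nz: "w * d v \<noteq> 0" using w that by simp
    have "1 - v / (w * d v) = (w * d v - v) / (w * d v)"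
      using nz by (simp add: diff_divide_distrib)
    also have "w * d v - v = w * (1 - v)" by (simp add: wd) (simp add: w_def algebra_simps)
    finally show "1 - v / (w * d v) = (1 - v) / d v" using w by simp
    have "1 - v / (w * d v) * x = (w * d v - v * x) / (w * d v)"
      using nz by (simp add: diff_divide_distrib)
    also have "w * d v - v * x = w * 1" by (simp add: wd) (simp add: w_def)
    finally show "1 - v / (w * d v) * x = 1 / d v" using w by simp
    have "1 - v / (w * d v) * y = (w * d v - v * y) / (w * d v)"
      using nz by (simp add: diff_divide_distrib)
    also have "w * d v - v * y = w * (1 - v * y')"
      using x by (simp add: wd) (simp add: w_def y'_def field_simps)
    finally show "1 - v / (w * d v) * y = (1 - v * y') / d v" using w by simp
  qed
  define f where "f = (\<lambda>u. A u * (inverse A * C) (1 - u) * (inverse B) (1 - u * x)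
      * (inverse B') (1 - u * y))"
  define g where "g = (\<lambda>v. (inverse A) w * (A v * (inverse A * C) (1 - v)
      * (inverse (inverse B * inverse B' * C)) (d v) * (inverse B') (1 - v * y')))"
  have summand: "f (v / (w * d v)) = g v" if "d v \<noteq> 0" for v
  proof -
    have "A (d v) \<noteq> 0" "B (d v) \<noteq> 0" "B' (d v) \<noteq> 0" "C (d v) \<noteq> 0" "A w \<noteq> 0"
      using that w ch by (auto dest: mult_char_nonzero)
    then show ?thesis
      unfolding f_def g_def u1[OF that] u2[OF that] u3[OF that]
      by (simp add: ch mult_char_divide mult_char_mult field_simps)
  qed
  define h where "h v = v / (w * d v)" for v
  define k where "k u = w * u / (1 - u * x)" for u
  have dk: "d (k u) = 1 / (1 - u * x)" if "1 - u * x \<noteq> 0" for u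
  proof -
    have "w * d (k u) = w + w * u * x / (1 - u * x)"
      unfolding wd by (simp add: k_def w_def)
    also have "\<dots> = w * ((1 - u * x + u * x) / (1 - u * x))"
      using that by (simp only: add_divide_distrib distrib_left) simp
    finally have "w * d (k u) = w * (1 / (1 - u * x))" by simp
    then show ?thesis by (simp only: mult_left_cancel[OF w])
  qed
  have kh: "k (h v) = v" if "d v \<noteq> 0" for v
    unfolding k_def h_def u2[OF that] using that w by simp
  have hk: "h (k u) = u" if "1 - u * x \<noteq> 0" for u
    using that w by (simp add: h_def dk) (simp add: k_def)
  have hx: "1 - h v * x \<noteq> 0" if "d v \<noteq> 0" for v
    unfolding h_def u2[OF that] using that by simp
  have "sum f UNIV = sum f {u. 1 - u * x \<noteq> 0}"
    by (rule sum.mono_neutral_right) (auto simp: f_def ch)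
  also have "\<dots> = sum g {v. d v \<noteq> 0}"
    by (rule sum.reindex_bij_witness[of _ h k])
      (use hk kh hx in \<open>auto simp: dk summand[folded h_def, symmetric]\<close>)
  also have "\<dots> = sum g UNIV"
    by (rule sum.mono_neutral_left) (auto simp: g_def ch)
  finally have sums: "sum f UNIV = sum g UNIV" .
  have eps: "\<epsilon> (x - y) * \<epsilon> (x * y) = \<epsilon> y * \<epsilon> (x / (x - 1) * y')"
    using x by (auto simp: trivial_char_def y'_def)
  have "\<epsilon> (x - y) * appell_F1 A B B' C x y = (\<epsilon> (x - y) * \<epsilon> (x * y)) * (A * C) (-1) * sum f UNIV"
    by (simp only: appell_F1_def f_def mult_ac)
  also have "\<dots> = (\<epsilon> y * \<epsilon> (x / (x - 1) * y')) * (A * C) (-1) * sum g UNIV"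
    by (simp only: eps sums)
  also have "\<dots> = \<epsilon> y * (inverse A) w
      * appell_F1 A (inverse B * inverse B' * C) B' C (x / (x - 1)) y'"
    unfolding appell_F1_def g_def d_def sum_distrib_left[symmetric] by (simp only: mult_ac)
  finally show ?thesis
    by (simp only: w_def y'_def)
qed

lemma appell_F1_pfaff_reflect:
  fixes A B B' C :: "'a::finite_field \<Rightarrow> complex"
  assumes ch: "mult_char A" "mult_char B" "mult_char B'" "mult_char C"
    and xy: "x \<noteq> 1" "y \<noteq> 1"
  shows "\<epsilon> (x - y) * appell_F1 A B B' C x y
    = \<epsilon> y * C (-1) * (inverse A * inverse B * C) (1 - x) * (inverse B') (1 - y)
        * appell_F1 (inverse A * C) (inverse B * inverse B' * C) B' C x ((x - y) / (1 - y))"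
proof -
  define x' where "x' = x / (x - 1)"
  define y' where "y' = (y - x) / (1 - x)"
  define D where "D = inverse B * inverse B' * C"
  have D: "mult_char D"
    unfolding D_def using ch by (intro mult_char_times mult_char_inverse)
  have nz: "1 - x \<noteq> 0" "x - 1 \<noteq> 0" "1 - y \<noteq> 0" using xy by auto
  have x'1: "1 - x' = 1 / (1 - x)"
    using nz by (simp add: x'_def field_simps)
  have y'1: "1 - y' = (1 - y) / (1 - x)"
    using nz by (simp add: y'_def field_simps)
  have ne: "x' \<noteq> 1" "y' \<noteq> 1"
    using x'1 y'1 nz by auto
  have "x' - 1 = - (1 / (1 - x))" "y' - 1 = - ((1 - y) / (1 - x))"
    by (simp_all only: x'1[symmetric] y'1[symmetric] minus_diff_eq)
  then have pullback: "x' / (x' - 1) = x" "y' / (y' - 1) = (x - y) / (1 - y)"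
    using nz by (simp_all add: x'_def y'_def) (simp_all add: field_simps)
  have chars: "(inverse A) (1 - x) * (inverse D) (1 - x') * (inverse B') (1 - y')
      = (inverse A * inverse B * C) (1 - x) * (inverse B') (1 - y)"
    using nz ch
    by (simp add: x'1 y'1 D_def mult_char_divide mult_char_nonzero) (simp add: divide_inverse)
  have "\<epsilon> (x - y) * appell_F1 A B B' C x y
      = \<epsilon> y * (inverse A) (1 - x) * appell_F1 A D B' C x' y'"
    unfolding x'_def y'_def D_def by (rule appell_F1_pfaff[OF ch xy(1)])
  also have "\<dots> = \<epsilon> y * C (-1) * ((inverse A) (1 - x) * (inverse D) (1 - x') * (inverse B') (1 - y'))
      * appell_F1 (inverse A * C) D B' C x ((x - y) / (1 - y))"
    unfolding appell_F1_reflect[OF ch(1) D ch(3,4) ne] pullback by (simp only: mult_ac)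
  finally show ?thesis
    unfolding chars unfolding D_def by (simp only: mult_ac)
qed

theorem theorem3p2:
  fixes A B B' C :: "'a::finite_field \<Rightarrow> complex"
    and x y :: 'a
  assumes "mult_char A" and "mult_char B" and "mult_char B'" and "mult_char C"
  shows
    "(x \<noteq> 1 \<and> y \<noteq> 1 \<longrightarrow>
        appell_F1 A B B' C x y
          = C (-1) * (inverse B) (1 - x) * (inverse B') (1 - y)
              * appell_F1 (inverse A * C) B B' C (x / (x - 1)) (y / (y - 1)))
     \<and>
     (x \<noteq> 1 \<longrightarrow>
        \<epsilon> (x - y) * appell_F1 A B B' C x y
          = \<epsilon> y * (inverse A) (1 - x)
              * appell_F1 A (inverse B * inverse B' * C) B' C (x / (x - 1)) ((y - x) / (1 - x)))
     \<and>
     (y \<noteq> 1 \<and> (x = 1 \<longrightarrow> y = 0) \<longrightarrow>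
        \<epsilon> (x - y) * appell_F1 A B B' C x y
          = \<epsilon> y * C (-1) * (inverse A * inverse B * C) (1 - x) * (inverse B') (1 - y)
              * appell_F1 (inverse A * C) (inverse B * inverse B' * C) B' C x ((x - y) / (1 - y)))"
proof (intro conjI impI)
  assume "x \<noteq> 1 \<and> y \<noteq> 1"
  then show "appell_F1 A B B' C x y
      = C (-1) * (inverse B) (1 - x) * (inverse B') (1 - y)
          * appell_F1 (inverse A * C) B B' C (x / (x - 1)) (y / (y - 1))"
    using appell_F1_reflect[OF assms] by blast
next
  assume "x \<noteq> 1"
  then show "\<epsilon> (x - y) * appell_F1 A B B' C x y
      = \<epsilon> y * (inverse A) (1 - x)
          * appell_F1 A (inverse B * inverse B' * C) B' C (x / (x - 1)) ((y - x) / (1 - x))"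
    by (rule appell_F1_pfaff[OF assms])
next
  assume xy: "y \<noteq> 1 \<and> (x = 1 \<longrightarrow> y = 0)"
  show "\<epsilon> (x - y) * appell_F1 A B B' C x y
      = \<epsilon> y * C (-1) * (inverse A * inverse B * C) (1 - x) * (inverse B') (1 - y)
          * appell_F1 (inverse A * C) (inverse B * inverse B' * C) B' C x ((x - y) / (1 - y))"
  proof (cases "x = 1")
    case True
    with xy show ?thesis by (simp add: appell_F1_def trivial_char_def)
  next
    case False
    with xy show ?thesis by (intro appell_F1_pfaff_reflect[OF assms]) auto
  qed
qed

end
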